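(* Let $C$ be a circle in the Euclidean plane, let $\ell$ be a line, and let $p, q, r, s \in \ell$ be four points not lying on $C$. For a point $x \in C \setminus \ell$ draw a chain of four chords starting at $x$ which go consecutively through $p, q, r, s$; that is, put $x_0 = x$, $x_1 = I_p(x_0)$, $x_2 = I_q(x_1)$, $x_3 = I_r(x_2)$, $x_4 = I_s(x_3)$. Say that the chain closes for $x$ if $x_4 = x_0$. If the chain closes for some $x \in C \setminus \ell$, then it closes for every $x \in C \setminus \ell$.
   Context: For a point $p$ of the plane not on the circle $C$, the map $I_p \colon C \to C$ sends $x \in C$ to the other end of the chord of $C$ cut out by the line through $x$ and $p$, i.e. to the second intersection point of the line $xp$ with $C$; if the line $xp$ is tangent to $C$ at $x$, then $I_p(x) = x$. (The point $p$ may lie inside or outside $C$; "chord through $p$" means that the line containing the chord passes through $p$.) *)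

theory Defs
  imports "HOL-Analysis.Analysis"
begin

text \<open>
  A line meets a circle in at most two points, so the description below is proper whenever
  \<open>C\<close> is a circle, \<open>x \<in> C\<close> and \<open>p \<notin> C\<close> (see \<open>chord_end_unique\<close>). The line is tangent to
  \<open>C\<close> at \<open>x\<close> when it meets \<open>C\<close> only in \<open>x\<close>. Since it is the full line through \<open>x\<close> and \<open>p\<close> that is
  intersected with \<open>C\<close>, the point \<open>p\<close> may lie inside or outside the circle.
\<close>

definition chord_map :: "(real^2) set \<Rightarrow> real^2 \<Rightarrow> real^2 \<Rightarrow> real^2" where
  "chord_map C p x =
     (if affine hull {x, p} \<inter> C = {x} then x
      else (THE y. y \<in> affine hull {x, p} \<inter> C \<and> y \<noteq> x))"

lemma chord_end_unique:
  fixes c p x y z :: "real^2"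
  assumes x: "x \<in> sphere c \<rho>"
    and y: "y \<in> affine hull {x, p} \<inter> sphere c \<rho>" "y \<noteq> x"
    and z: "z \<in> affine hull {x, p} \<inter> sphere c \<rho>" "z \<noteq> x"
  shows "y = z"
proof -
  define d where "d = p - x"
  have *: "\<exists>t. w = x + t *\<^sub>R d \<and> t * (d \<bullet> d) = - 2 * ((x - c) \<bullet> d)"
    if w: "w \<in> affine hull {x, p} \<inter> sphere c \<rho>" "w \<noteq> x" for w
  proof -
    from w obtain u v where uv: "w = u *\<^sub>R x + v *\<^sub>R p" "u + v = 1"
      by (auto simp: affine_hull_2)
    then have u: "u = 1 - v" by simp
    have wv: "w = x + v *\<^sub>R d"
      using uv(1) unfolding u d_def by (simp add: algebra_simps)
    with w have "v \<noteq> 0" by auto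
    have "(w - c) \<bullet> (w - c) = (x - c) \<bullet> (x - c)"
      using w x by (simp add: dist_norm norm_minus_commute flip: power2_norm_eq_inner)
    moreover have "w - c = (x - c) + v *\<^sub>R d" using wv by simp
    ultimately have "2 * v * ((x - c) \<bullet> d) + v * v * (d \<bullet> d) = 0"
      by (simp add: inner_add_left inner_add_right inner_commute algebra_simps)
    then have "v * (2 * ((x - c) \<bullet> d) + v * (d \<bullet> d)) = 0" by (simp add: algebra_simps)
    with \<open>v \<noteq> 0\<close> have "v * (d \<bullet> d) = - 2 * ((x - c) \<bullet> d)" by simp
    with wv show ?thesis by blast
  qed
  obtain t where t: "y = x + t *\<^sub>R d" "t * (d \<bullet> d) = - 2 * ((x - c) \<bullet> d)" using *[OF y] by blast
  obtain t' where t': "z = x + t' *\<^sub>R d" "t' * (d \<bullet> d) = - 2 * ((x - c) \<bullet> d)" using *[OF z] by blast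
  have "d \<noteq> 0" using t(1) y(2) by auto
  then have "t = t'" using t(2) t'(2) by (metis inner_eq_zero_iff mult_right_cancel)
  then show ?thesis using t(1) t'(1) by simp
qed

end

theory Submission
  imports Defs
begin

text \<open>
  Choose coordinates in which \<open>\<ell>\<close> is the axis \<open>Y = 0\<close> and the circle is
  \<open>X\<^sup>2 + Y\<^sup>2 - 2 k Y + m = 0\<close>, and pass to the projective chart \<open>U = X / Y\<close>, \<open>W = 1 / Y\<close>,
  which sends \<open>\<ell>\<close> to infinity. For \<open>p \<in> \<ell>\<close> the map \<open>I\<^sub>p\<close> becomes the reflection \<open>U \<mapsto> -U\<close>
  followed by a member of a two-parameter family of affine maps that is closed under composition
  and normalised by this reflection. Hence a chain of four chords is a single member of the family,
  with parameters independent of \<open>x\<close>, and the only member fixing a point of the conic is the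
  identity.
\<close>

section \<open>Composition and fixed points of the affine family\<close>

text \<open>
  For \<open>m \<noteq> 0\<close> these are the similarities of the quadratic form \<open>U\<^sup>2 + m W\<^sup>2\<close> about its
  centre \<open>(0, k / m)\<close>; written in this way they still make sense for \<open>m = 0\<close>, where the conic
  is a parabola.
\<close>

definition conic_map :: "real \<Rightarrow> real \<Rightarrow> real \<Rightarrow> real \<Rightarrow> real \<times> real \<Rightarrow> real \<times> real" where
  "conic_map m k \<beta> \<delta> =
     (\<lambda>(U, W). (U - m * \<delta> * U - \<beta> * (m * W - k), W + \<beta> * U - \<delta> * (m * W - k)))"

definition flip :: "real \<times> real \<Rightarrow> real \<times> real" where
  "flip = (\<lambda>(U, W). (- U, W))"

lemma flip_flip [simp]: "flip (flip v) = v"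
  by (cases v) (simp add: flip_def)

lemma flip_conic_map: "flip (conic_map m k \<beta> \<delta> v) = conic_map m k (- \<beta>) \<delta> (flip v)"
  by (cases v) (simp add: flip_def conic_map_def algebra_simps)

text \<open>In the coordinates \<open>(U, P)\<close> with \<open>P = m * W - k\<close> the map acts
  as \<open>(1 - m * \<delta>) + \<beta> * j\<close>, where \<open>j\<close> sends
  \<open>(U, P)\<close> to \<open>(- P, m * U)\<close> and squares to \<open>- m\<close>. The new
  parameters are read off from the product of two such elements.\<close>

lemma conic_map_compose:
  "conic_map m k \<beta>' \<delta>' (conic_map m k \<beta> \<delta> v) =
   conic_map m k (\<beta> + \<beta>' - m * (\<beta>' * \<delta> + \<delta>' * \<beta>)) (\<delta> + \<delta>' - m * \<delta> * \<delta>' + \<beta> * \<beta>') v"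
  by (cases v) (simp add: conic_map_def algebra_simps)

lemma conic_map_0 [simp]: "conic_map m k 0 0 v = v"
  by (cases v) (simp add: conic_map_def)

text \<open>Being a fixed point is a homogeneous linear system in \<open>\<beta>\<close> and
  \<open>\<delta>\<close>. Up to sign its determinant is \<open>m * U\<^sup>2 + P\<^sup>2\<close>,
  which on the conic has the constant value \<open>k\<^sup>2 - m\<close>.\<close>

lemma conic_map_fixed_point:
  assumes conic: "U\<^sup>2 + 1 - 2 * k * W + m * W\<^sup>2 = 0" and pos: "k\<^sup>2 > m"
    and fix_eq: "conic_map m k \<beta> \<delta> (U, W) = (U, W)"
  shows "\<beta> = 0" and "\<delta> = 0"
proof -
  define P where "P = m * W - k"
  have 1: "m * \<delta> * U + \<beta> * P = 0" and 2: "\<beta> * U - \<delta> * P = 0"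
    using fix_eq by (auto simp: conic_map_def P_def)
  have "m * U\<^sup>2 + P\<^sup>2 = m * (U\<^sup>2 + 1 - 2 * k * W + m * W\<^sup>2) + (k\<^sup>2 - m)"
    by (simp add: P_def power2_eq_square algebra_simps)
  with conic pos have nz: "m * U\<^sup>2 + P\<^sup>2 \<noteq> 0" by simp
  have "\<beta> * (m * U\<^sup>2 + P\<^sup>2) = P * (m * \<delta> * U + \<beta> * P) + m * U * (\<beta> * U - \<delta> * P)"
    by (simp add: power2_eq_square algebra_simps)
  with 1 2 nz show "\<beta> = 0" by simp
  have "\<delta> * (m * U\<^sup>2 + P\<^sup>2) = U * (m * \<delta> * U + \<beta> * P) - P * (\<beta> * U - \<delta> * P)"
    by (simp add: power2_eq_square algebra_simps)
  with 1 2 nz show "\<delta> = 0" by simp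
qed

section \<open>Chord maps as inversions, and their form in the chart\<close>

text \<open>The chord map at \<open>p\<close> is the inversion whose power is the power of \<open>p\<close> with respect to the circle.\<close>

lemma chord_map_sphere:
  fixes c p x :: "real^2"
  assumes x: "x \<in> sphere c \<rho>" and p: "p \<notin> sphere c \<rho>"
  defines "\<tau> \<equiv> ((norm (p - c))\<^sup>2 - \<rho>\<^sup>2) / (norm (x - p))\<^sup>2"
  shows "chord_map (sphere c \<rho>) p x = p + \<tau> *\<^sub>R (x - p)"
    and "p + \<tau> *\<^sub>R (x - p) \<in> sphere c \<rho>"
proof -
  define y where "y = p + \<tau> *\<^sub>R (x - p)"
  have "x \<noteq> p" using x p by auto
  then have nz: "(norm (x - p))\<^sup>2 \<noteq> 0" by simp
  have rho: "\<rho> \<ge> 0" using x by (auto simp: dist_norm)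
  have tau: "\<tau> * (norm (x - p))\<^sup>2 = (norm (p - c))\<^sup>2 - \<rho>\<^sup>2"
    using nz by (simp add: \<tau>_def)
  have sphere_iff: "z \<in> sphere c \<rho> \<longleftrightarrow> (norm (z - c))\<^sup>2 = \<rho>\<^sup>2" for z
    using rho by (simp add: dist_norm norm_minus_commute)
  have expand: "(norm (p + t *\<^sub>R (x - p) - c))\<^sup>2
      = (norm (p - c))\<^sup>2 + 2 * t * ((x - p) \<bullet> (p - c)) + t\<^sup>2 * (norm (x - p))\<^sup>2" for t
    unfolding power2_norm_eq_inner
    by (simp add: inner_add_left inner_add_right inner_diff_left inner_diff_right
        inner_commute power2_eq_square algebra_simps)
  have "(norm (p - c))\<^sup>2 + 2 * ((x - p) \<bullet> (p - c)) + (norm (x - p))\<^sup>2 = \<rho>\<^sup>2"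
    using expand[of 1] x unfolding sphere_iff by simp
  \<comment> \<open>Along the line through \<open>x\<close> and \<open>p\<close> the circle equation
    is a quadratic in \<open>t\<close> with root 1 at \<open>x\<close>. The product of its roots is
    the power of \<open>p\<close> over the squared distance, namely \<open>\<tau>\<close>, so their
    sum is \<open>\<tau> + 1\<close>.\<close>
  then have lin: "2 * ((x - p) \<bullet> (p - c)) = - (\<tau> + 1) * (norm (x - p))\<^sup>2"
    using tau by (simp add: algebra_simps)
  have factor: "(norm (p + t *\<^sub>R (x - p) - c))\<^sup>2 - \<rho>\<^sup>2 = (t - 1) * (t - \<tau>) * (norm (x - p))\<^sup>2" for t
  proof -
    have "(norm (p + t *\<^sub>R (x - p) - c))\<^sup>2 - \<rho>\<^sup>2
        = ((norm (p - c))\<^sup>2 - \<rho>\<^sup>2) + t * (2 * ((x - p) \<bullet> (p - c))) + t\<^sup>2 * (norm (x - p))\<^sup>2"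
      by (simp add: expand)
    then show ?thesis
      unfolding lin tau[symmetric] by (simp add: power2_eq_square algebra_simps)
  qed
  have hull: "z \<in> affine hull {x, p} \<longleftrightarrow> (\<exists>t. z = p + t *\<^sub>R (x - p))" for z
    unfolding insert_commute[of x p] affine_hull_2_alt by auto
  have meet: "affine hull {x, p} \<inter> sphere c \<rho> = {x, y}"
  proof -
    have "p + t *\<^sub>R (x - p) \<in> sphere c \<rho> \<longleftrightarrow> t = 1 \<or> t = \<tau>" for t
    proof -
      have "p + t *\<^sub>R (x - p) \<in> sphere c \<rho> \<longleftrightarrow> (t - 1) * (t - \<tau>) * (norm (x - p))\<^sup>2 = 0"
        unfolding factor[symmetric] sphere_iff by simp
      with nz show ?thesis by simp
    qed
    then have "z \<in> affine hull {x, p} \<inter> sphere c \<rho> \<longleftrightarrow>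
        (\<exists>t. z = p + t *\<^sub>R (x - p) \<and> (t = 1 \<or> t = \<tau>))" for z
      unfolding Int_iff hull by metis
    then have "z \<in> affine hull {x, p} \<inter> sphere c \<rho> \<longleftrightarrow> z = x \<or> z = y" for z
      by (simp only: y_def conj_disj_distribL ex_disj_distrib) simp
    then show ?thesis by blast
  qed
  then show "p + \<tau> *\<^sub>R (x - p) \<in> sphere c \<rho>" unfolding y_def by blast
  show "chord_map (sphere c \<rho>) p x = p + \<tau> *\<^sub>R (x - p)"
    unfolding chord_map_def meet y_def[symmetric]
    \<comment> \<open>The case \<open>y = x\<close> is tangency, where
      \<open>\<tau> = 1\<close>.\<close>
    by (cases "y = x") (auto intro!: the_equality)
qed

text \<open>The chords pass through \<open>(a, 0)\<close>. On the circle the squared distance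
  \<open>D\<close> to this point is affine in \<open>X\<close> and \<open>Y\<close>, so dividing by
  \<open>Y\<close> leaves an affine expression in the chart coordinates.\<close>

lemma inversion_in_chart:
  fixes X Y k m a :: real
  assumes circle: "X\<^sup>2 + Y\<^sup>2 - 2 * k * Y + m = 0" and Y: "Y \<noteq> 0" and pow: "a\<^sup>2 + m \<noteq> 0"
  defines "\<tau> \<equiv> (a\<^sup>2 + m) / ((X - a)\<^sup>2 + Y\<^sup>2)"
  shows "((a + \<tau> * (X - a)) / (\<tau> * Y), 1 / (\<tau> * Y)) =
     conic_map m k (2 * a / (a\<^sup>2 + m)) (2 / (a\<^sup>2 + m)) (flip (X / Y, 1 / Y))"
proof -
  define N where "N = a\<^sup>2 + m"
  define D where "D = (X - a)\<^sup>2 + Y\<^sup>2"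
  have D: "D = a\<^sup>2 - m - 2 * a * X + 2 * k * Y"
    using circle by (simp add: D_def power2_eq_square algebra_simps)
  have "D > 0" using Y by (simp add: D_def add_nonneg_pos)
  then have D0: "D \<noteq> 0" by simp
  have N0: "N \<noteq> 0" using pow by (simp add: N_def)
  have tau: "\<tau> = N / D" by (simp add: \<tau>_def N_def D_def)
  have 1: "(a + \<tau> * (X - a)) / (\<tau> * Y) = (a * D + N * (X - a)) / (N * Y)"
    using D0 N0 Y by (simp add: tau field_simps)
  have 2: "1 / (\<tau> * Y) = D / (N * Y)"
    by (simp add: tau)
  have numerator: "a * D + N * (X - a) = - (N * X) + 2 * m * X - 2 * a * (m - k * Y)"
    unfolding D N_def by (simp add: power2_eq_square algebra_simps)
  have 3: "(a * D + N * (X - a)) / (N * Y)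
      = - (X / Y) - m * (2 / N) * - (X / Y) - 2 * a / N * (m * (1 / Y) - k)"
    unfolding numerator using N0 Y by (simp add: field_simps)
  have D_N: "D = N - 2 * a * X - 2 * (m - k * Y)"
    unfolding D N_def by simp
  have 4: "D / (N * Y) = 1 / Y + 2 * a / N * - (X / Y) - 2 / N * (m * (1 / Y) - k)"
    unfolding D_N using N0 Y by (simp add: field_simps)
  show ?thesis
    unfolding 1 2 N_def[symmetric] conic_map_def flip_def prod.case prod.inject
    using 3 4 by blast
qed

section \<open>Coordinates adapted to the line\<close>

locale line_frame =
  fixes c a u :: "real^2" and \<rho> :: real
  assumes unit: "norm u = 1"
begin

definition n :: "real^2" where "n = vector [- u $ 2, u $ 1]"

text \<open>Measured from \<open>c\<close> rather than \<open>a\<close>, so that the circle equation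
  has no linear term in this coordinate.\<close>

definition along :: "real^2 \<Rightarrow> real" where "along x = (x - c) \<bullet> u"

definition height :: "real^2 \<Rightarrow> real" where "height x = (x - a) \<bullet> n"

definition chart :: "real^2 \<Rightarrow> real \<times> real" where
  "chart x = (along x / height x, 1 / height x)"

definition k :: real where "k = height c"

text \<open>The power, with respect to the circle, of the foot of the perpendicular from
  \<open>c\<close> to the line. It vanishes when the line is tangent.\<close>

definition m :: real where "m = k\<^sup>2 - \<rho>\<^sup>2"

lemma unit_coords: "(u $ 1)\<^sup>2 + (u $ 2)\<^sup>2 = 1"
  using unit by (simp add: norm_eq_1 inner_vec_def sum_2 power2_eq_square)

lemma n_coords: "n $ 1 = - u $ 2" "n $ 2 = u $ 1"
  by (simp_all add: n_def)

lemma frame_expand: "v = (v \<bullet> u) *\<^sub>R u + (v \<bullet> n) *\<^sub>R n"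
proof -
  have "v $ 1 = v $ 1 * ((u $ 1)\<^sup>2 + (u $ 2)\<^sup>2)" "v $ 2 = v $ 2 * ((u $ 1)\<^sup>2 + (u $ 2)\<^sup>2)"
    by (simp_all add: unit_coords)
  then show ?thesis
    by (simp add: vec_eq_iff forall_2 inner_vec_def sum_2 n_coords power2_eq_square algebra_simps)
qed

lemma norm_frame: "(norm v)\<^sup>2 = (v \<bullet> u)\<^sup>2 + (v \<bullet> n)\<^sup>2"
proof -
  have "(norm v)\<^sup>2 = v \<bullet> ((v \<bullet> u) *\<^sub>R u + (v \<bullet> n) *\<^sub>R n)"
    using frame_expand[of v] by (simp add: power2_norm_eq_inner)
  then show ?thesis by (simp add: inner_add_right power2_eq_square)
qed

lemma orthogonal: "u \<bullet> n = 0"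
  by (simp add: inner_vec_def sum_2 n_coords)

lemma norm_diff_frame:
  "(norm (x - y))\<^sup>2 = (along x - along y)\<^sup>2 + (height x - height y)\<^sup>2"
  unfolding norm_frame[of "x - y"] by (simp add: along_def height_def inner_diff_left)

lemma along_c [simp]: "along c = 0"
  by (simp add: along_def)

lemma height_eq_0_iff: "height x = 0 \<longleftrightarrow> (\<exists>t. x = a + t *\<^sub>R u)"
proof
  assume "height x = 0"
  then have "x - a = ((x - a) \<bullet> u) *\<^sub>R u"
    using frame_expand[of "x - a"] by (simp add: height_def)
  then show "\<exists>t. x = a + t *\<^sub>R u" by (metis add.commute diff_add_cancel)
next
  assume "\<exists>t. x = a + t *\<^sub>R u"
  then show "height x = 0" by (auto simp: height_def orthogonal)
qed

lemma chart_inject: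
  assumes "chart x = chart y" "height x \<noteq> 0" "height y \<noteq> 0"
  shows "x = y"
proof -
  have h: "height x = height y" and "along x = along y"
    using assms by (auto simp: chart_def)
  then have "(norm (x - y))\<^sup>2 = 0" by (simp add: norm_diff_frame)
  then show ?thesis by simp
qed

lemma circle_eq:
  assumes "x \<in> sphere c \<rho>"
  shows "(along x)\<^sup>2 + (height x)\<^sup>2 - 2 * k * height x + m = 0"
proof -
  have "(norm (x - c))\<^sup>2 = \<rho>\<^sup>2" using assms by (simp add: dist_norm norm_minus_commute)
  then have "(along x)\<^sup>2 + (height x - k)\<^sup>2 = \<rho>\<^sup>2"
    unfolding norm_diff_frame by (simp add: k_def)
  then show ?thesis
    by (simp add: m_def power2_eq_square algebra_simps)
qed

lemma chart_conic:
  assumes "x \<in> sphere c \<rho>" "height x \<noteq> 0"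
  shows "(fst (chart x))\<^sup>2 + 1 - 2 * k * snd (chart x) + m * (snd (chart x))\<^sup>2 = 0"
proof -
  have "(fst (chart x))\<^sup>2 + 1 - 2 * k * snd (chart x) + m * (snd (chart x))\<^sup>2
      = ((along x)\<^sup>2 + (height x)\<^sup>2 - 2 * k * height x + m) / (height x)\<^sup>2"
    using assms(2) by (simp add: chart_def field_simps power2_eq_square)
  then show ?thesis using circle_eq[OF assms(1)] by simp
qed

text \<open>The denominator is the power of \<open>p\<close> with respect to the circle.\<close>

definition beta :: "real^2 \<Rightarrow> real" where "beta p = 2 * along p / ((along p)\<^sup>2 + m)"

definition delta :: "real^2 \<Rightarrow> real" where "delta p = 2 / ((along p)\<^sup>2 + m)"

text \<open>The first two claims allow the third to be iterated along a chain. The image stays off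
  the line because the power of \<open>p\<close>, and hence \<open>\<tau>\<close>, is
  nonzero.\<close>

lemma chord_map_chart:
  assumes x: "x \<in> sphere c \<rho>" "height x \<noteq> 0" and p: "p \<notin> sphere c \<rho>" "height p = 0"
  shows "chord_map (sphere c \<rho>) p x \<in> sphere c \<rho>"
    and "height (chord_map (sphere c \<rho>) p x) \<noteq> 0"
    and "chart (chord_map (sphere c \<rho>) p x) = conic_map m k (beta p) (delta p) (flip (chart x))"
proof -
  define \<tau> where "\<tau> = ((norm (p - c))\<^sup>2 - \<rho>\<^sup>2) / (norm (x - p))\<^sup>2"
  have y: "chord_map (sphere c \<rho>) p x = p + \<tau> *\<^sub>R (x - p)"
    using chord_map_sphere(1)[OF x(1) p(1)] by (simp add: \<tau>_def)
  show "chord_map (sphere c \<rho>) p x \<in> sphere c \<rho>"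
    using chord_map_sphere[OF x(1) p(1)] by simp
  have pow: "(norm (p - c))\<^sup>2 - \<rho>\<^sup>2 = (along p)\<^sup>2 + m"
    by (simp add: norm_diff_frame p(2) m_def k_def)
  have "\<rho> \<ge> 0" using x(1) by (auto simp: dist_norm)
  then have pow0: "(along p)\<^sup>2 + m \<noteq> 0"
    using p(1) unfolding pow[symmetric] by (simp add: dist_norm norm_minus_commute)
  have tau: "\<tau> = ((along p)\<^sup>2 + m) / ((along x - along p)\<^sup>2 + (height x)\<^sup>2)"
    unfolding \<tau>_def pow by (simp add: norm_diff_frame p(2))
  have "x \<noteq> p" using x(1) p(1) by auto
  then have tau0: "\<tau> \<noteq> 0" using pow0 unfolding \<tau>_def pow by simp
  have hy: "height (p + \<tau> *\<^sub>R (x - p)) = \<tau> * height x"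
  proof -
    have "height (p + \<tau> *\<^sub>R (x - p)) = height p + \<tau> * (height x - height p)"
      by (simp add: height_def inner_diff_left inner_add_left algebra_simps)
    then show ?thesis by (simp add: p(2))
  qed
  have ay: "along (p + \<tau> *\<^sub>R (x - p)) = along p + \<tau> * (along x - along p)"
    by (simp add: along_def inner_diff_left inner_add_left algebra_simps)
  show "height (chord_map (sphere c \<rho>) p x) \<noteq> 0"
    using tau0 x(2) by (simp add: y hy)
  show "chart (chord_map (sphere c \<rho>) p x) = conic_map m k (beta p) (delta p) (flip (chart x))"
    using inversion_in_chart[OF circle_eq[OF x(1)] x(2) pow0]
    unfolding y chart_def hy ay beta_def delta_def tau[symmetric] .
qed

text \<open>Moving the reflections through the affine maps cancels them in pairs, since their number
  is even. The parameters are fixed before \<open>x\<close> is chosen; this uniformity carries the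
  closing property from one point to all.\<close>

lemma four_chords:
  assumes "p \<notin> sphere c \<rho>" "q \<notin> sphere c \<rho>" "r \<notin> sphere c \<rho>" "s \<notin> sphere c \<rho>"
    and "height p = 0" "height q = 0" "height r = 0" "height s = 0"
  defines "F \<equiv> \<lambda>x. chord_map (sphere c \<rho>) s (chord_map (sphere c \<rho>) r
                   (chord_map (sphere c \<rho>) q (chord_map (sphere c \<rho>) p x)))"
  obtains \<beta> \<delta> where
    "\<And>x. x \<in> sphere c \<rho> \<Longrightarrow> height x \<noteq> 0 \<Longrightarrow>
       height (F x) \<noteq> 0 \<and> chart (F x) = conic_map m k \<beta> \<delta> (chart x)"
proof -
  have "\<exists>\<beta> \<delta>. \<forall>v. conic_map m k (beta s) (delta s) (flip (conic_map m k (beta r) (delta r)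
      (flip (conic_map m k (beta q) (delta q) (flip (conic_map m k (beta p) (delta p) (flip v)))))))
      = conic_map m k \<beta> \<delta> v"
    unfolding flip_conic_map flip_flip conic_map_compose by blast
  then obtain \<beta> \<delta> where *: "\<And>v. conic_map m k (beta s) (delta s) (flip (conic_map m k (beta r) (delta r)
      (flip (conic_map m k (beta q) (delta q) (flip (conic_map m k (beta p) (delta p) (flip v)))))))
      = conic_map m k \<beta> \<delta> v" by blast
  show ?thesis
  proof (rule that)
    fix x assume "x \<in> sphere c \<rho>" "height x \<noteq> 0"
    then show "height (F x) \<noteq> 0 \<and> chart (F x) = conic_map m k \<beta> \<delta> (chart x)"
      unfolding F_def *[symmetric]
      by (simp only: chord_map_chart assms(1-8) not_False_eq_True simp_thms)
  qed
qed

lemma porism: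
  assumes "\<rho> > 0"
    and pts: "p \<notin> sphere c \<rho>" "q \<notin> sphere c \<rho>" "r \<notin> sphere c \<rho>" "s \<notin> sphere c \<rho>"
      "height p = 0" "height q = 0" "height r = 0" "height s = 0"
  defines "F \<equiv> \<lambda>x. chord_map (sphere c \<rho>) s (chord_map (sphere c \<rho>) r
                   (chord_map (sphere c \<rho>) q (chord_map (sphere c \<rho>) p x)))"
  assumes x: "x \<in> sphere c \<rho>" "height x \<noteq> 0" "F x = x"
    and y: "y \<in> sphere c \<rho>" "height y \<noteq> 0"
  shows "F y = y"
proof -
  obtain \<beta> \<delta> where *: "\<And>x. x \<in> sphere c \<rho> \<Longrightarrow> height x \<noteq> 0 \<Longrightarrow>
       height (F x) \<noteq> 0 \<and> chart (F x) = conic_map m k \<beta> \<delta> (chart x)"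
    using four_chords[OF pts] unfolding F_def by metis
  have "conic_map m k \<beta> \<delta> (fst (chart x), snd (chart x)) = (fst (chart x), snd (chart x))"
    using *[OF x(1,2)] x(3) by simp
  \<comment> \<open>The difference is \<open>\<rho>\<^sup>2\<close>, so the positive radius makes
    the fixed-point system nonsingular.\<close>
  moreover have "k\<^sup>2 > m" using \<open>\<rho> > 0\<close> by (simp add: m_def)
  ultimately have "\<beta> = 0" "\<delta> = 0"
    using conic_map_fixed_point chart_conic[OF x(1,2)] by blast+
  then show ?thesis using *[OF y] y(2) by (auto intro: chart_inject)
qed

end

section \<open>Parametrising the line and conclusion\<close>

lemma affine_line_unit_direction:
  fixes L :: "'a::euclidean_space set"
  assumes "affine L" "aff_dim L = 1"
  obtains a u where "norm u = 1" "L = {a + t *\<^sub>R u | t. True}"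
proof -
  obtain B where B: "\<not> affine_dependent B" "affine hull B = L" "card B = 2"
  proof -
    obtain B where B: "\<not> affine_dependent B" "affine hull L = affine hull B"
      using affine_basis_exists by blast
    \<comment> \<open>An affine basis has one more point than the dimension.\<close>
    then have "int (card B) = 2"
      using aff_dim_unique[of B L] assms(2) by simp
    then show ?thesis
      using that[of B] B assms(1) by (simp add: affine_hull_eq[THEN iffD2])
  qed
  then obtain a b where ab: "B = {a, b}" "a \<noteq> b" by (auto simp: card_2_iff)
  define u where "u = (1 / norm (b - a)) *\<^sub>R (b - a)"
  have u: "norm u = 1" "b - a = norm (b - a) *\<^sub>R u" using ab(2) by (simp_all add: u_def)
  have "x \<in> L \<longleftrightarrow> (\<exists>t. x = a + t *\<^sub>R u)" for x
  proof -
    have "x \<in> L \<longleftrightarrow> (\<exists>t. x = a + t *\<^sub>R (b - a))"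
      unfolding B(2)[symmetric] ab(1) affine_hull_2_alt by auto
    also have "\<dots> \<longleftrightarrow> (\<exists>t. x = a + t *\<^sub>R u)"
    proof
      assume "\<exists>t. x = a + t *\<^sub>R (b - a)"
      then show "\<exists>t. x = a + t *\<^sub>R u" 
        by (subst (asm) u(2)) auto
    next
      assume "\<exists>t. x = a + t *\<^sub>R u"
      then show "\<exists>t. x = a + t *\<^sub>R (b - a)" by (auto simp: u_def)
    qed
    finally show ?thesis .
  qed
  then show ?thesis using that[of u a] u(1) by blast
qed

theorem theorem1:
  fixes c :: "real^2" and \<rho> :: real
    and C L :: "(real^2) set"
    and p q r s :: "real^2"
  assumes "\<rho> > 0" and "C = sphere c \<rho>"
    and "affine L" and "aff_dim L = 1"
    and "p \<in> L" and "q \<in> L" and "r \<in> L" and "s \<in> L"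
    and "p \<notin> C" and "q \<notin> C" and "r \<notin> C" and "s \<notin> C"
    and "\<exists>x \<in> C - L. chord_map C s (chord_map C r (chord_map C q (chord_map C p x))) = x"
  shows "\<forall>x \<in> C - L. chord_map C s (chord_map C r (chord_map C q (chord_map C p x))) = x"
proof -
  obtain a u where u: "norm u = 1" and L: "L = {a + t *\<^sub>R u | t. True}"
    using affine_line_unit_direction[OF assms(3,4)] by metis
  interpret line_frame c a u \<rho> using u by unfold_locales
  have L_iff: "x \<in> L \<longleftrightarrow> height x = 0" for x
    unfolding height_eq_0_iff L by blast
  show ?thesis
    using assms(13) porism[OF \<open>\<rho> > 0\<close>, of p q r s] assms(5-12)
    unfolding \<open>C = sphere c \<rho>\<close> L_iff by (metis DiffE L_iff)
qed

end
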